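(* Let $k$ be a positive integer. Every $k$-arc-connected digraph has a spanning $k$-arc-connected $(2k+1)$-partite subdigraph. This is best possible: there are infinitely many (pairwise non-isomorphic) $k$-arc-connected digraphs with no spanning $k$-arc-connected $2k$-partite subdigraph.
   Context: Digraphs are finite and may have multiple (parallel) arcs, but no loops. A digraph $D=(V,A)$ is $k$-arc-connected if for every non-empty proper subset $X\subset V$ there are at least $k$ arcs with tail in $X$ and head in $V\setminus X$. A subdigraph is spanning if it contains all vertices. A digraph is $r$-partite if its vertex set can be partitioned into $r$ (possibly empty) sets each of which induces no arc. *)

theory Defs
  imports "Graph_Theory.Graph_Theory" "HOL-Library.Disjoint_Sets"
begin

text \<open>Finite, loopless, parallel arcs allowed (unlike the locale \<^locale>\<open>digraph\<close>).\<close>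
locale multi_digraph = fin_digraph + loopfree_digraph

definition cut_arcs :: "('a, 'b) pre_digraph \<Rightarrow> 'a set \<Rightarrow> 'b set" where
  "cut_arcs G X = {e \<in> arcs G. tail G e \<in> X \<and> head G e \<in> verts G - X}"

definition arc_connected :: "nat \<Rightarrow> ('a, 'b) pre_digraph \<Rightarrow> bool" where
  "arc_connected k G \<longleftrightarrow> (\<forall>X. X \<noteq> {} \<and> X \<subset> verts G \<longrightarrow> k \<le> card (cut_arcs G X))"

text \<open>The classes \<^term>\<open>P i\<close> may be empty, so they are given as an indexed family.\<close>
definition partite :: "nat \<Rightarrow> ('a, 'b) pre_digraph \<Rightarrow> bool" where
  "partite r G \<longleftrightarrow> (\<exists>P :: nat \<Rightarrow> 'a set.
     (\<Union>i<r. P i) = verts G \<and> disjoint_family_on P {..<r} \<and>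
     (\<forall>i<r. arcs (induce_subgraph G (P i)) = {}))"

end

theory Submission
  imports Defs "HOL-Library.Nat_Bijection"
begin

text \<open>
  Represent a digraph by its arc multiplicities. A minimal \<open>k\<close>-arc-connected subdigraph has, by a
  theorem of Mader, a vertex \<open>s\<close> of in- and out-degree \<open>k\<close>. Splitting off all arcs at \<open>s\<close> in pairs
  keeps the rest \<open>k\<close>-arc-connected (Mader's directed splitting theorem), so by induction the rest
  has a \<open>k\<close>-arc-connected subdigraph that is \<open>(2k+1)\<close>-coloured. Discarding its split arcs and
  putting back all \<open>2k\<close> arcs at \<open>s\<close> preserves connectivity, and at most \<open>2k\<close> colours are forbidden
  for \<open>s\<close>.

  For sharpness, take a regular tournament on \<open>2k+1\<close> vertices and enlarge it only at one vertex: the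
  other \<open>2k\<close> vertices keep in- and out-degree \<open>k\<close>, so no arc of the tournament can be spared.
\<close>

section \<open>Weighted cuts\<close>

text \<open>\<open>X\<close> and \<open>Y\<close> are arbitrary sets, so that one notation covers
  cuts, the degrees \<open>cap c {x} V\<close> and \<open>cap c V {x}\<close>, and the weight
  \<open>cap c X X\<close> inside a set.\<close>

definition cap :: "('a \<Rightarrow> 'a \<Rightarrow> nat) \<Rightarrow> 'a set \<Rightarrow> 'a set \<Rightarrow> nat" where
  "cap c X Y = (\<Sum>x\<in>X. \<Sum>y\<in>Y. c x y)"

definition cut_connected :: "nat \<Rightarrow> 'a set \<Rightarrow> ('a \<Rightarrow> 'a \<Rightarrow> nat) \<Rightarrow> bool" where
  "cut_connected k V c \<longleftrightarrow> (\<forall>X. X \<noteq> {} \<and> X \<subset> V \<longrightarrow> k \<le> cap c X (V - X))"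

lemma cut_connectedD: "cut_connected k V c \<Longrightarrow> X \<noteq> {} \<Longrightarrow> X \<subset> V \<Longrightarrow> k \<le> cap c X (V - X)"
  by (simp add: cut_connected_def)

lemma cap_Un_left:
  "finite A \<Longrightarrow> finite B \<Longrightarrow> A \<inter> B = {} \<Longrightarrow> cap c (A \<union> B) Y = cap c A Y + cap c B Y"
  by (simp add: cap_def sum.union_disjoint)

lemma cap_Un_right:
  "finite A \<Longrightarrow> finite B \<Longrightarrow> A \<inter> B = {} \<Longrightarrow> cap c X (A \<union> B) = cap c X A + cap c X B"
  by (simp add: cap_def sum.union_disjoint sum.distrib)

lemma cap_empty [simp]: "cap c {} Y = 0" "cap c X {} = 0"
  by (simp_all add: cap_def)

text \<open>Reversing all arcs swaps out-cuts and in-cuts, so results on out-cuts can be reused for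
  in-cuts through \<open>cap_converse\<close>.\<close>

definition rev_weight :: "('a \<Rightarrow> 'a \<Rightarrow> nat) \<Rightarrow> 'a \<Rightarrow> 'a \<Rightarrow> nat" where
  "rev_weight c x y = c y x"

lemma cap_converse: "cap (rev_weight c) X Y = cap c Y X"
  unfolding cap_def rev_weight_def by (rule sum.swap)

lemma cap_add: "cap (\<lambda>x y. c x y + d x y) X Y = cap c X Y + cap d X Y"
  by (simp add: cap_def sum.distrib)

lemma cap_mono:
  assumes "\<And>x y. x \<in> X \<Longrightarrow> y \<in> Y \<Longrightarrow> c x y \<le> d x y"
  shows "cap c X Y \<le> cap d X Y"
  unfolding cap_def by (intro sum_mono assms)

lemma cap_subset:
  assumes "finite X'" "finite Y'" "X \<subseteq> X'" "Y \<subseteq> Y'"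
  shows "cap c X Y \<le> cap c X' Y'"
proof -
  have "cap c X Y \<le> (\<Sum>x\<in>X. \<Sum>y\<in>Y'. c x y)"
    unfolding cap_def by (intro sum_mono sum_mono2) (use assms in auto)
  also have "\<dots> \<le> cap c X' Y'"
    unfolding cap_def by (intro sum_mono2) (use assms in auto)
  finally show ?thesis .
qed

lemma cap_diff_right:
  assumes "finite W" "Z \<subseteq> W"
  shows "cap c X W = cap c X Z + cap c X (W - Z)"
proof -
  have W: "W = Z \<union> (W - Z)" using assms by auto
  show ?thesis by (subst W, rule cap_Un_right) (use assms in \<open>auto intro: finite_subset\<close>)
qed

lemma cap_diff_left:
  assumes "finite W" "Z \<subseteq> W"
  shows "cap c W Y = cap c Z Y + cap c (W - Z) Y"
  using cap_diff_right[OF assms, of "rev_weight c" Y] by (simp add: cap_converse)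

text \<open>Split \<open>V\<close> into \<open>X - Y\<close>, \<open>Y - X\<close>,
  \<open>X \<inter> Y\<close> and the rest. Arcs between these parts count at least as often on the
  right; the surplus is exactly the arcs between \<open>X - Y\<close> and
  \<open>Y - X\<close>.\<close>

lemma cap_uncross:
  assumes "finite V" "X \<subseteq> V" "Y \<subseteq> V"
  shows "cap c (X \<inter> Y) (V - X \<inter> Y) + cap c (X \<union> Y) (V - (X \<union> Y)) \<le>
    cap c X (V - X) + cap c Y (V - Y)"
proof -
  define A B C D where "A = X - Y" "B = Y - X" "C = X \<inter> Y" "D = V - (X \<union> Y)"
  note d = this
  have fin: "finite A" "finite B" "finite C" "finite D"
    using assms by (auto simp: d intro: finite_subset)
  have dj: "A \<inter> B = {}" "A \<inter> C = {}" "A \<inter> D = {}" "B \<inter> C = {}" "B \<inter> D = {}" "C \<inter> D = {}"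
    "B \<inter> A = {}" "C \<inter> A = {}" "D \<inter> A = {}" "C \<inter> B = {}" "D \<inter> B = {}" "D \<inter> C = {}"
    by (auto simp: d)
  have e: "X \<inter> Y = C" "V - X \<inter> Y = A \<union> (B \<union> D)" "X \<union> Y = A \<union> (B \<union> C)" "V - (X \<union> Y) = D"
    "X = A \<union> C" "V - X = B \<union> D" "Y = B \<union> C" "V - Y = A \<union> D"
    using assms by (auto simp: d)
  show ?thesis
    unfolding e(2) e(4) unfolding e(1) e(3) e(6) e(8) unfolding e(5) e(7)
    using fin dj by (simp add: cap_Un_left cap_Un_right Int_Un_distrib Int_Un_distrib2)
qed

text \<open>Submodularity for \<open>V - X\<close> and \<open>Y\<close>; it uncrosses a set measured
  by entering arcs with one measured by leaving arcs.\<close>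

lemma cap_uncross_mixed:
  assumes "finite V" "X \<subseteq> V" "Y \<subseteq> V"
  shows "cap c (V - (X - Y)) (X - Y) + cap c (Y - X) (V - (Y - X)) \<le>
    cap c (V - X) X + cap c Y (V - Y)"
proof -
  have e: "(V - X) \<inter> Y = Y - X" "(V - X) \<union> Y = V - (X - Y)" "V - (V - X) = X"
    "V - (V - (X - Y)) = X - Y"
    using assms by auto
  show ?thesis
    using cap_uncross[of V "V - X" Y c] assms unfolding e by simp
qed

section \<open>Splitting off\<close>

text \<open>For arcs \<open>us\<close> and \<open>sv\<close>, where \<open>a\<close> and \<open>b\<close> count the arcs to and from a vertex \<open>s\<close> outside \<open>V\<close>:
  the pair can be split off unless a tight set contains both \<open>u\<close> and \<open>v\<close>. By uncrossing there is a
  largest tight set containing \<open>u\<close>, and it cannot contain all out-neighbours of \<open>s\<close>.\<close>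

lemma admissible_split:
  fixes w :: "'a \<Rightarrow> 'a \<Rightarrow> nat"
  assumes fin: "finite V" and ab: "sum a V = sum b V"
    and out: "\<And>X. X \<noteq> {} \<Longrightarrow> X \<subset> V \<Longrightarrow> k \<le> cap w X (V - X) + sum a X"
    and inn: "\<And>X. X \<noteq> {} \<Longrightarrow> X \<subset> V \<Longrightarrow> k \<le> cap w (V - X) X + sum b X"
    and u: "u \<in> V" "0 < a u"
  shows "\<exists>v\<in>V. 0 < b v \<and> (\<forall>X. X \<subset> V \<and> u \<in> X \<and> v \<in> X \<longrightarrow>
    k < cap w X (V - X) + sum a X \<and> k < cap w (V - X) X + sum b X)"
proof -
  \<comment> \<open>\<open>O' X\<close> and \<open>I' X\<close> are the out- and in-degree of
    \<open>X\<close> while \<open>s\<close> is still present; \<open>X\<close> is tight if one of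
    them equals \<open>k\<close>.\<close>
  define O' where "O' X = cap w X (V - X) + sum a X" for X
  define I' where "I' X = cap w (V - X) X + sum b X" for X
  have O: "k \<le> O' X" and I: "k \<le> I' X" if "X \<noteq> {}" "X \<subset> V" for X
    using out[OF that] inn[OF that] by (simp_all add: O'_def I'_def)
  have finX: "finite X" if "X \<subseteq> V" for X using that fin by (rule finite_subset)
  have aV: "sum a V = sum a X + sum a (V - X)" and bV: "sum b V = sum b X + sum b (V - X)"
    if "X \<subseteq> V" for X
    using sum.subset_diff[OF that fin] by (simp_all add: add.commute)
  have aX: "0 < sum a X" if "u \<in> X" "X \<subseteq> V" for X
    using that u finX[OF that(2)] by (metis gr0I sum_eq_0_iff)
  have comp: "V - X \<noteq> {}" "V - X \<subset> V" "V - (V - X) = X" if "u \<in> X" "X \<subset> V" for X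
    using that by auto
  \<comment> \<open>The arcs of \<open>V\<close> leaving \<open>X\<close> are those entering
    \<open>V - X\<close>. Comparing \<open>O' X = k\<close> with \<open>I' (V - X) \<ge> k\<close>
    leaves only the arcs at \<open>s\<close>.\<close>
  have ot: "sum a X \<le> sum b (V - X)" if "u \<in> X" "X \<subset> V" "O' X = k" for X
    using I[OF comp(1,2)[OF that(1,2)]] that comp(3)[OF that(1,2)] by (simp add: O'_def I'_def)
  have it: "sum b X \<le> sum a (V - X)" if "u \<in> X" "X \<subset> V" "I' X = k" for X
    using O[OF comp(1,2)[OF that(1,2)]] that comp(3)[OF that(1,2)] by (simp add: O'_def I'_def)
  define F where "F = {X. X \<subset> V \<and> u \<in> X \<and> (O' X = k \<or> I' X = k)}"
  have un_sum: "sum f (X \<union> Y) + sum f (X \<inter> Y) = sum f X + sum f Y"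
    if "X \<subseteq> V" "Y \<subseteq> V" for f :: "'a \<Rightarrow> nat" and X Y
    using sum.union_inter[of X Y f] finX that by blast
  have OO: "X \<union> Y \<in> F" if "X \<subset> V" "Y \<subset> V" "u \<in> X" "u \<in> Y" "O' X = k" "O' Y = k" for X Y
  proof -
    \<comment> \<open>If the union were \<open>V\<close>, the complements would be disjoint and
      \<open>ot\<close> would bound \<open>sum a X + sum a Y\<close> by
      \<open>sum b V = sum a V\<close>; but the arcs from \<open>u\<close> to \<open>s\<close> are
      counted twice on the left.\<close>
    have "X \<union> Y \<noteq> V"
    proof
      assume XY: "X \<union> Y = V"
      have "sum a X + sum a Y \<le> sum b (V - X) + sum b (V - Y)"
        using ot that by (intro add_mono) auto
      also have "\<dots> = sum b ((V - X) \<union> (V - Y))"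
        by (rule sum.union_disjoint[symmetric]) (use XY fin in auto)
      also have "\<dots> \<le> sum b V" by (rule sum_mono2) (use fin in auto)
      finally have "sum a X + sum a Y \<le> sum a V" using ab by simp
      moreover have "sum a V + sum a (X \<inter> Y) = sum a X + sum a Y"
        using un_sum[of X Y a] XY that by auto
      moreover have "0 < sum a (X \<inter> Y)" by (rule aX) (use that in auto)
      ultimately show False by linarith
    qed
    then have sub: "X \<union> Y \<subset> V" using that by auto
    have "O' (X \<inter> Y) + O' (X \<union> Y) \<le> O' X + O' Y"
      using cap_uncross[OF fin, of X Y w] un_sum[of X Y a] that by (auto simp: O'_def)
    moreover have "k \<le> O' (X \<inter> Y)" by (rule O) (use that in auto)
    moreover have "k \<le> O' (X \<union> Y)" by (rule O) (use that sub in auto)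
    ultimately have "O' (X \<union> Y) = k" using that by linarith
    then show ?thesis using sub that by (auto simp: F_def)
  qed
  have II: "X \<union> Y \<in> F" if "X \<subset> V" "Y \<subset> V" "u \<in> X" "u \<in> Y" "I' X = k" "I' Y = k" for X Y
  proof -
    \<comment> \<open>Here \<open>it\<close> bounds \<open>sum b X + sum b Y\<close>, which is at
      least \<open>sum b V\<close>, by a sum of \<open>a\<close> that omits \<open>u\<close> and
      hence is less than \<open>sum a V\<close>.\<close>
    have "X \<union> Y \<noteq> V"
    proof
      assume XY: "X \<union> Y = V"
      have "sum b X + sum b Y \<le> sum a (V - X) + sum a (V - Y)"
        using it that by (intro add_mono) auto
      also have "\<dots> = sum a ((V - X) \<union> (V - Y))"
        by (rule sum.union_disjoint[symmetric]) (use XY fin in auto)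
      also have "(V - X) \<union> (V - Y) = V - X \<inter> Y" by auto
      finally have "sum b X + sum b Y \<le> sum a (V - X \<inter> Y)" .
      moreover have "sum b V + sum b (X \<inter> Y) = sum b X + sum b Y"
        using un_sum[of X Y b] XY that by auto
      moreover have "sum a V = sum a (X \<inter> Y) + sum a (V - X \<inter> Y)" by (rule aV) (use that in auto)
      moreover have "0 < sum a (X \<inter> Y)" by (rule aX) (use that in auto)
      ultimately show False using ab by linarith
    qed
    then have sub: "X \<union> Y \<subset> V" using that by auto
    have "I' (X \<inter> Y) + I' (X \<union> Y) \<le> I' X + I' Y"
      using cap_uncross[OF fin, of X Y "rev_weight w"] un_sum[of X Y b] that
      by (auto simp: I'_def cap_converse)
    moreover have "k \<le> I' (X \<inter> Y)" by (rule I) (use that in auto)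
    moreover have "k \<le> I' (X \<union> Y)" by (rule I) (use that sub in auto)
    ultimately have "I' (X \<union> Y) = k" using that by linarith
    then show ?thesis using sub that by (auto simp: F_def)
  qed
  \<comment> \<open>If not nested, both differences are nonempty and have degree at least
    \<open>k\<close>. Mixed uncrossing contradicts this, because the arcs from \<open>u\<close> to
    \<open>s\<close> count in \<open>O' Y\<close> but not in \<open>O' (Y - X)\<close>.\<close>
  have IO: "X \<subseteq> Y \<or> Y \<subseteq> X" if "X \<subset> V" "Y \<subset> V" "u \<in> X" "u \<in> Y" "I' X = k" "O' Y = k" for X Y
  proof (rule ccontr)
    assume "\<not> ?thesis"
    then have "k \<le> I' (X - Y)" "k \<le> O' (Y - X)"
      by (intro I O; use that in auto)+
    moreover have "sum b (X - Y) \<le> sum b X" by (rule sum_mono2) (use that finX in auto)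
    moreover have "sum a (Y - X) + sum a (X \<inter> Y) = sum a Y"
      using sum.subset_diff[of "X \<inter> Y" Y a] finX that by (auto simp: Diff_Int)
    moreover have "0 < sum a (X \<inter> Y)" by (rule aX) (use that in auto)
    moreover have "cap w (V - (X - Y)) (X - Y) + cap w (Y - X) (V - (Y - X)) \<le>
      cap w (V - X) X + cap w Y (V - Y)"
      by (rule cap_uncross_mixed) (use that fin in auto)
    ultimately show False using that(5,6) unfolding I'_def O'_def by linarith
  qed
  have Fun: "X \<subseteq> Y \<or> Y \<subseteq> X \<or> X \<union> Y \<in> F" if "X \<in> F" "Y \<in> F" for X Y
    using that OO[of X Y] II[of X Y] IO[of X Y] IO[of Y X] unfolding F_def by blast
  \<comment> \<open>\<open>M\<close> will be the largest tight set containing \<open>u\<close>, or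
    empty if there is none. No tight set contains both \<open>u\<close> and a vertex outside
    \<open>M\<close>.\<close>
  have "\<exists>M\<subseteq>V. (\<forall>X\<in>F. X \<subseteq> M) \<and> (\<exists>v\<in>V - M. 0 < b v)"
  proof (cases "F = {}")
    case True
    have "sum b V \<noteq> 0" using ab aX[OF u(1)] by simp
    then have "\<exists>v\<in>V. b v \<noteq> 0" by (meson sum.neutral)
    with True show ?thesis by (intro exI[of _ "{}"]) auto
  next
    case False
    have finF: "finite F" using fin by (auto simp: F_def intro: finite_subset[of _ "Pow V"])
    obtain M where M: "M \<in> F" and max: "\<And>X. X \<in> F \<Longrightarrow> \<not> M \<subset> X"
      using finite_has_maximal[OF finF False] by (metis psubset_eq)
    have all: "X \<subseteq> M" if "X \<in> F" for X
      using Fun[OF M that] max[OF that] max[of "M \<union> X"] by blast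
    have MV: "M \<subset> V" "u \<in> M" using M by (auto simp: F_def)
    \<comment> \<open>If \<open>s\<close> sent no arc outside \<open>M\<close>, then
      \<open>ot\<close> would give \<open>sum a M = 0\<close> despite \<open>u\<close>, while
      \<open>it\<close> would give \<open>sum b V \<le> sum a (V - M) < sum a V\<close>.\<close>
    have "sum b (V - M) \<noteq> 0"
    proof
      assume 0: "sum b (V - M) = 0"
      show False
      proof (cases "O' M = k")
        case True
        then show False using ot[OF MV(2,1) True] 0 aX[OF MV(2)] MV by auto
      next
        case False
        then have "I' M = k" using M by (auto simp: F_def)
        then have "sum b M \<le> sum a (V - M)" using it MV by blast
        then show False using 0 aX[OF MV(2)] aV[of M] bV[of M] ab MV by auto
      qed
    qed
    then have "\<exists>v\<in>V - M. b v \<noteq> 0" by (meson sum.neutral)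
    with all MV show ?thesis by (intro exI[of _ M]) auto
  qed
  then obtain M v where M: "\<And>X. X \<in> F \<Longrightarrow> X \<subseteq> M" and v: "v \<in> V - M" "0 < b v" by blast
  show ?thesis
  proof (intro bexI[of _ v] conjI allI impI)
    fix X assume X: "X \<subset> V \<and> u \<in> X \<and> v \<in> X"
    then have "X \<notin> F" using M v by auto
    then have "O' X \<noteq> k" "I' X \<noteq> k" using X by (auto simp: F_def)
    moreover have "k \<le> O' X" "k \<le> I' X" using O[of X] I[of X] X by auto
    ultimately show "k < cap w X (V - X) + sum a X" "k < cap w (V - X) X + sum b X"
      by (auto simp: O'_def I'_def)
  qed (use v in auto)
qed

lemma cap_indicator:
  assumes "finite X" "finite Y"
  shows "cap (\<lambda>x y. if x = u \<and> y = v then 1 else 0) X Y = (if u \<in> X \<and> v \<in> Y then 1 else 0)"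
proof -
  have "cap (\<lambda>x y. if x = u \<and> y = v then 1 else 0) X Y =
      (\<Sum>x\<in>X. if x = u then (\<Sum>y\<in>Y. if y = v then 1 else 0) else 0)"
    unfolding cap_def by (intro sum.cong refl) auto
  then show ?thesis using assms by simp
qed

text \<open>\<open>t x y\<close> counts the pairs \<open>xs\<close>, \<open>sy\<close> replaced by
  an arc \<open>xy\<close>; its marginals say that every arc at \<open>s\<close> is used exactly
  once. The induction splits off one admissible pair at a time. Loops may arise, but they cross no
  cut.\<close>

lemma split_off:
  fixes w :: "'a \<Rightarrow> 'a \<Rightarrow> nat"
  assumes fin: "finite V" and "sum a V = sum b V"
    and "\<And>X. X \<noteq> {} \<Longrightarrow> X \<subset> V \<Longrightarrow> k \<le> cap w X (V - X) + sum a X"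
    and "\<And>X. X \<noteq> {} \<Longrightarrow> X \<subset> V \<Longrightarrow> k \<le> cap w (V - X) X + sum b X"
  shows "\<exists>t. (\<forall>x\<in>V. (\<Sum>y\<in>V. t x y) = a x) \<and> (\<forall>y\<in>V. (\<Sum>x\<in>V. t x y) = b y) \<and>
    cut_connected k V (\<lambda>x y. w x y + t x y)"
  using assms(2-)
proof (induction "sum a V" arbitrary: a b w)
  case 0
  then have "\<forall>x\<in>V. a x = 0" "\<forall>x\<in>V. b x = 0" using fin by (auto simp: sum_eq_0_iff)
  moreover have "k \<le> cap w X (V - X)" if "X \<noteq> {}" "X \<subset> V" for X
    using 0(3)[OF that] that calculation(1) by (simp add: psubset_eq subset_iff)
  ultimately show ?case
    by (intro exI[of _ "\<lambda>_ _. 0"]) (auto simp: cut_connected_def)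
next
  case (Suc n)
  have "sum a V \<noteq> 0" using Suc(2) by simp
  then obtain u where u: "u \<in> V" "0 < a u" by (metis gr0I sum.neutral)
  obtain v where v: "v \<in> V" "0 < b v" and adm: "\<And>X. X \<subset> V \<Longrightarrow> u \<in> X \<Longrightarrow> v \<in> X \<Longrightarrow>
    k < cap w X (V - X) + sum a X \<and> k < cap w (V - X) X + sum b X"
    using admissible_split[OF fin Suc(3-5) u] by blast
  define \<delta> :: "'a \<Rightarrow> 'a \<Rightarrow> nat" where "\<delta> x y = (if x = u \<and> y = v then 1 else 0)" for x y
  define a' b' where "a' x = (if x = u then a x - 1 else a x)"
    and "b' x = (if x = v then b x - 1 else b x)" for x
  have cap\<delta>: "cap \<delta> X Y = (if u \<in> X \<and> v \<in> Y then 1 else 0)" if "finite X" "finite Y" for X Y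
    unfolding \<delta>_def using that by (rule cap_indicator)
  have a: "a x = a' x + (if x = u then 1 else 0)" and b: "b x = b' x + (if x = v then 1 else 0)" for x
    using u v by (auto simp: a'_def b'_def)
  have sa: "sum a X = sum a' X + (if u \<in> X then 1 else 0)"
    and sb: "sum b X = sum b' X + (if v \<in> X then 1 else 0)" if "finite X" for X
    using that by (simp_all add: a b sum.distrib)
  have "n = sum a' V" "sum a' V = sum b' V" using Suc(2,3) sa[OF fin] sb[OF fin] u v by auto
  moreover have "k \<le> cap (\<lambda>x y. w x y + \<delta> x y) X (V - X) + sum a' X"
    and "k \<le> cap (\<lambda>x y. w x y + \<delta> x y) (V - X) X + sum b' X" if X: "X \<noteq> {}" "X \<subset> V" for X
  proof -
    have f: "finite X" "finite (V - X)" using X fin by (auto intro: finite_subset)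
    \<comment> \<open>If \<open>X\<close> contains \<open>u\<close> but not \<open>v\<close>, the
      new arc replaces the lost arc \<open>us\<close>; if \<open>X\<close> contains both, the strict
      inequality in \<open>adm\<close> absorbs the loss. The in-cuts are analogous.\<close>
    show "k \<le> cap (\<lambda>x y. w x y + \<delta> x y) X (V - X) + sum a' X"
      using Suc(4)[OF X] adm[OF X(2)] v u sa[OF f(1)]
      by (auto simp: cap_add cap\<delta>[OF f] split: if_splits)
    show "k \<le> cap (\<lambda>x y. w x y + \<delta> x y) (V - X) X + sum b' X"
      using Suc(5)[OF X] adm[OF X(2)] v u sb[OF f(1)]
      by (auto simp: cap_add cap\<delta>[OF f(2,1)] split: if_splits)
  qed
  ultimately obtain t where t: "\<forall>x\<in>V. (\<Sum>y\<in>V. t x y) = a' x" "\<forall>y\<in>V. (\<Sum>x\<in>V. t x y) = b' y"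
    "cut_connected k V (\<lambda>x y. w x y + \<delta> x y + t x y)"
    using Suc(1)[of a' b' "\<lambda>x y. w x y + \<delta> x y"] by blast
  have \<delta>1: "(\<Sum>y\<in>V. \<delta> x y) = (if x = u then 1 else 0)" for x
    using v fin by (cases "x = u") (auto simp: \<delta>_def)
  have \<delta>2: "(\<Sum>x\<in>V. \<delta> x y) = (if y = v then 1 else 0)" for y
    using u fin by (cases "y = v") (auto simp: \<delta>_def)
  show ?case
    by (intro exI[of _ "\<lambda>x y. \<delta> x y + t x y"])
      (use t in \<open>auto simp: sum.distrib \<delta>1 \<delta>2 a b add.assoc\<close>)
qed

section \<open>Minimally connected weights\<close>

lemma cap_eq_sum_left: "finite X \<Longrightarrow> cap c X Y = (\<Sum>x\<in>X. cap c {x} Y)"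
  by (simp add: cap_def)

lemma cap_eq_sum_right: "cap c X Y = (\<Sum>y\<in>Y. cap c X {y})"
  by (subst cap_converse[symmetric]) (simp add: cap_def rev_weight_def)

lemma cut_connected_converse:
  assumes "cut_connected k V c"
  shows "cut_connected k V (rev_weight c)"
  unfolding cut_connected_def cap_converse
proof (intro allI impI)
  fix X assume "X \<noteq> {} \<and> X \<subset> V"
  then have X: "X \<subset> V" "X \<noteq> {}" by simp_all
  then have "V - (V - X) = X" by auto
  then show "k \<le> cap c (V - X) X"
    using cut_connectedD[OF assms, of "V - X"] X by auto
qed

text \<open>At least \<open>(k + 1) * card P\<close> arcs start in \<open>P\<close>. None of them
  ends in \<open>Q\<close>, so each ends in \<open>S = Y - Q\<close> or leaves \<open>Y\<close>. The
  vertices of \<open>S\<close> have in-degree at most \<open>k\<close>, so too few arcs can end in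
  \<open>S\<close>. The extra \<open>k\<close> comes from the arcs entering \<open>P\<close> from
  outside if \<open>S = P\<close>, and from \<open>card S < card P\<close> otherwise.\<close>

lemma degree_excess:
  assumes fin: "finite V" and conn: "cut_connected k V c"
    and Y: "Y \<subseteq> V" and P: "P = {v\<in>Y. k < cap c {v} V}" and Q: "Q = {v\<in>Y. k < cap c V {v}}"
    and PQ: "Y \<subseteq> P \<union> Q" and none: "\<And>x y. x \<in> P \<Longrightarrow> y \<in> Q \<Longrightarrow> c x y = 0"
    and "P \<noteq> {}"
  shows "cap c P (V - Y) > (if P \<subset> V then k else 0)"
proof -
  define S where "S = Y - Q"
  have SP: "S \<subseteq> P" using PQ by (auto simp: S_def)
  have sub: "P \<subseteq> V" "Q \<subseteq> Y" "S \<subseteq> V" using Y by (auto simp: P Q S_def)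
  have f: "finite P" "finite Q" "finite S" "finite Y"
    using finite_subset[OF _ fin] sub Y by (auto simp: P Q S_def)
  have "cap c P V = cap c P Y + cap c P (V - Y)" by (rule cap_diff_right) (use Y fin in auto)
  also have "cap c P Y = cap c P Q + cap c P S"
    unfolding S_def by (rule cap_diff_right) (use f sub in auto)
  also have "cap c P Q = 0" using none by (simp add: cap_def)
  finally have 1: "cap c P V = cap c P S + cap c P (V - Y)" by simp
  have "k * card P + card P = (\<Sum>x\<in>P. k + 1)" by simp
  also have "\<dots> \<le> (\<Sum>x\<in>P. cap c {x} V)" by (rule sum_mono) (auto simp: P)
  also have "\<dots> = cap c P V" using cap_eq_sum_left[OF f(1), of c V] by (rule sym)
  finally have 2: "k * card P + card P \<le> cap c P V" .
  have "cap c V S \<le> (\<Sum>y\<in>S. k)"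
    unfolding cap_eq_sum_right[of c V S] by (rule sum_mono) (use sub Y in \<open>auto simp: S_def Q\<close>)
  then have 3: "cap c V S \<le> k * card S" by (simp add: mult.commute)
  have 4: "cap c V S = cap c P S + cap c (V - P) S"
    by (rule cap_diff_left) (use sub fin in auto)
  have cP: "0 < card P" using f assms(8) by (simp add: card_gt_0_iff)
  show ?thesis
  proof (cases "S = P")
    case True
    define b where "b = (if P \<subset> V then k else 0)"
    have "b \<le> cap c (V - P) P"
      using cut_connectedD[OF cut_connected_converse[OF conn] assms(8)]
      by (simp add: b_def cap_converse)
    then have "b < cap c P (V - Y)" using 1 2 3 4 cP unfolding True by linarith
    then show ?thesis by (simp only: b_def)
  next
    case False
    then have "S \<subset> P" using SP by auto
    then have "card S + 1 \<le> card P" using psubset_card_mono[OF f(1)] by (simp add: Suc_leI)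
    then have "k * (card S + 1) \<le> k * card P" by (rule mult_le_mono2)
    then have "k < cap c P (V - Y)" using 1 2 3 4 cP unfolding distrib_left mult_1_right by linarith
    then show ?thesis by simp
  qed
qed

section \<open>Tight sets crossed by arcs between vertices of excess degree\<close>

definition excess_arc :: "nat \<Rightarrow> 'a set \<Rightarrow> ('a \<Rightarrow> 'a \<Rightarrow> nat) \<Rightarrow> 'a \<Rightarrow> 'a \<Rightarrow> bool" where
  "excess_arc k V c x y \<longleftrightarrow> x \<in> V \<and> y \<in> V \<and> 0 < c x y \<and> k < cap c {x} V \<and> k < cap c V {y}"

text \<open>Only tight sets left by an excess arc are covered; those entered by one are obtained
  from \<open>rev_weight c\<close>.\<close>

definition tight_excess :: "nat \<Rightarrow> 'a set \<Rightarrow> ('a \<Rightarrow> 'a \<Rightarrow> nat) \<Rightarrow> 'a set \<Rightarrow> bool" where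
  "tight_excess k V c Y \<longleftrightarrow> Y \<subset> V \<and> cap c Y (V - Y) = k \<and>
     (\<exists>x y. excess_arc k V c x y \<and> x \<in> Y \<and> y \<notin> Y)"

lemma excess_arc_converse: "excess_arc k V (rev_weight c) x y \<longleftrightarrow> excess_arc k V c y x"
  by (auto simp: excess_arc_def cap_converse rev_weight_def)

lemma tight_excess_converse:
  "tight_excess k V (rev_weight c) Y \<longleftrightarrow> Y \<subset> V \<and> cap c (V - Y) Y = k \<and>
     (\<exists>x y. excess_arc k V c x y \<and> x \<notin> Y \<and> y \<in> Y)"
  by (auto simp: tight_excess_def cap_converse excess_arc_converse)

text \<open>An excess arc inside \<open>Y\<close> would leave some tight \<open>X\<close>. If
  \<open>X\<close> and \<open>Y\<close> cover \<open>V\<close>, then \<open>V - X\<close> is a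
  smaller set of the reversed kind; otherwise uncrossing makes \<open>Y \<inter> X\<close> a smaller
  tight set. So \<open>Y\<close> spans no excess arc, and \<open>degree_excess\<close> sends more
  than \<open>k\<close> arcs out of \<open>Y\<close>.\<close>

lemma no_minimal_tight_excess:
  assumes fin: "finite V" and conn: "cut_connected k V c"
    and min: "\<And>x y. x \<in> V \<Longrightarrow> y \<in> V \<Longrightarrow> 0 < c x y \<Longrightarrow>
       \<exists>X\<subset>V. x \<in> X \<and> y \<notin> X \<and> cap c X (V - X) = k"
    and big: "\<And>x. x \<in> V \<Longrightarrow> k < cap c {x} V \<or> k < cap c V {x}"
    and Y: "tight_excess k V c Y"
    and Ymin: "\<And>Z. Z \<subset> Y \<Longrightarrow> \<not> tight_excess k V c Z"
      "\<And>Z. Z \<subset> Y \<Longrightarrow> \<not> tight_excess k V (rev_weight c) Z"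
  shows False
proof -
  have YV: "Y \<subset> V" "cap c Y (V - Y) = k" using Y by (auto simp: tight_excess_def)
  have inner: "\<not> excess_arc k V c x y" if xy: "x \<in> Y" "y \<in> Y" for x y
  proof
    assume e: "excess_arc k V c x y"
    then obtain X where X: "X \<subset> V" "x \<in> X" "y \<notin> X" "cap c X (V - X) = k"
      using min by (auto simp: excess_arc_def)
    show False
    proof (cases "Y \<union> X = V")
      case True
      have "V - (V - X) = X" using X by auto
      then have "tight_excess k V (rev_weight c) (V - X)"
        unfolding tight_excess_converse using X e xy by (auto simp: excess_arc_def)
      moreover have "V - X \<subset> Y" using True xy X by auto
      ultimately show False using Ymin by blast
    next
      case False
      then have s: "Y \<union> X \<subset> V" "Y \<inter> X \<subset> V" using YV X by auto
      have ne: "Y \<inter> X \<noteq> {}" "Y \<union> X \<noteq> {}" using xy X by auto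
      have "cap c (Y \<inter> X) (V - Y \<inter> X) + cap c (Y \<union> X) (V - (Y \<union> X)) \<le> k + k"
        using cap_uncross[OF fin, of Y X c] YV X by auto
      then have "cap c (Y \<inter> X) (V - Y \<inter> X) = k"
        using cut_connectedD[OF conn ne(1) s(2)] cut_connectedD[OF conn ne(2) s(1)] by linarith
      then have "tight_excess k V c (Y \<inter> X)"
        unfolding tight_excess_def using s e xy X by blast
      moreover have "Y \<inter> X \<subset> Y" using xy X by auto
      ultimately show False using Ymin by blast
    qed
  qed
  define P where "P = {v\<in>Y. k < cap c {v} V}"
  define Q where "Q = {v\<in>Y. k < cap c V {v}}"
  have "P \<noteq> {}" using Y by (auto simp: tight_excess_def excess_arc_def P_def)
  moreover have "Y \<subseteq> P \<union> Q" using big YV by (auto simp: P_def Q_def)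
  moreover have "c x y = 0" if "x \<in> P" "y \<in> Q" for x y
    using inner[of x y] that YV by (auto simp: P_def Q_def excess_arc_def)
  ultimately have "cap c P (V - Y) > (if P \<subset> V then k else 0)"
    by (intro degree_excess[OF fin conn _ P_def Q_def]) (use YV in auto)
  moreover have "P \<subset> V" using YV by (auto simp: P_def)
  moreover have "cap c P (V - Y) \<le> cap c Y (V - Y)"
    by (rule cap_subset) (use YV fin in \<open>auto simp: P_def intro: finite_subset\<close>)
  ultimately show False using YV by simp
qed

text \<open>If every vertex had in- or out-degree above \<open>k\<close>, then counting degrees would give an excess arc.
  By minimality it leaves a tight set. Among the tight sets left or entered by an excess arc a
  smallest one spans no excess arc, and counting degrees inside it yields a contradiction.\<close>

lemma exists_vertex_of_degree_k:
  assumes fin: "finite V" and "V \<noteq> {}" and conn: "cut_connected k V c"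
    and deg: "\<And>x. x \<in> V \<Longrightarrow> k \<le> cap c {x} V" "\<And>x. x \<in> V \<Longrightarrow> k \<le> cap c V {x}"
    and min: "\<And>x y. x \<in> V \<Longrightarrow> y \<in> V \<Longrightarrow> 0 < c x y \<Longrightarrow>
       \<exists>X\<subset>V. x \<in> X \<and> y \<notin> X \<and> cap c X (V - X) = k"
  shows "\<exists>s\<in>V. cap c {s} V = k \<and> cap c V {s} = k"
proof (rule ccontr)
  assume none: "\<not> ?thesis"
  have big: "k < cap c {x} V \<or> k < cap c V {x}" if "x \<in> V" for x
    using deg(1)[OF that] deg(2)[OF that] none that by (metis le_neq_implies_less)
  let ?r = "rev_weight c"
  have conn': "cut_connected k V ?r" by (rule cut_connected_converse) fact
  have min': "\<exists>X\<subset>V. x \<in> X \<and> y \<notin> X \<and> cap ?r X (V - X) = k"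
    if xy: "x \<in> V" "y \<in> V" "0 < rev_weight c x y" for x y
  proof -
    obtain X where X: "X \<subset> V" "y \<in> X" "x \<notin> X" "cap c X (V - X) = k"
      using min[OF xy(2,1)] xy(3) by (auto simp: rev_weight_def)
    have "V - (V - X) = X" using X by auto
    then show ?thesis using X xy by (intro exI[of _ "V - X"]) (auto simp: cap_converse)
  qed
  \<comment> \<open>Without excess arcs, \<open>degree_excess\<close> applies with
    \<open>Y = V\<close>, where \<open>cap c P (V - Y)\<close> is zero; hence \<open>P\<close> is
    empty, and by reversal so is \<open>Q\<close>, although they cover \<open>V\<close>.\<close>
  have "\<exists>x y. excess_arc k V c x y"
  proof (rule ccontr)
    assume no: "\<not> ?thesis"
    define P where "P = {v\<in>V. k < cap c {v} V}"
    define Q where "Q = {v\<in>V. k < cap c V {v}}"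
    have PQ: "V \<subseteq> P \<union> Q" using big by (auto simp: P_def Q_def)
    have z: "c x y = 0" if "x \<in> P" "y \<in> Q" for x y
      using no that by (auto simp: P_def Q_def excess_arc_def)
    have "P = {}"
    proof (rule ccontr)
      assume "P \<noteq> {}"
      then show False using degree_excess[OF fin conn subset_refl P_def Q_def PQ z] by simp
    qed
    moreover have "Q = {}"
    proof (rule ccontr)
      have rev: "Q = {v\<in>V. k < cap ?r {v} V}" "P = {v\<in>V. k < cap ?r V {v}}"
        by (simp_all add: P_def Q_def cap_converse)
      have "V \<subseteq> Q \<union> P" using PQ by auto
      moreover have "?r x y = 0" if "x \<in> Q" "y \<in> P" for x y
        using z[OF that(2,1)] by (simp add: rev_weight_def)
      moreover assume "Q \<noteq> {}"
      ultimately show False using degree_excess[OF fin conn' subset_refl rev] by simp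
    qed
    ultimately show False using PQ \<open>V \<noteq> {}\<close> by auto
  qed
  then obtain x y where e: "excess_arc k V c x y" by blast
  then obtain X where "X \<subset> V" "x \<in> X" "y \<notin> X" "cap c X (V - X) = k"
    using min by (auto simp: excess_arc_def)
  with e have X: "tight_excess k V c X" by (auto simp: tight_excess_def)
  \<comment> \<open>Both kinds are collected, since uncrossing inside a minimal set can produce a
    set of the other kind.\<close>
  define T where "T = {Y. tight_excess k V c Y \<or> tight_excess k V ?r Y}"
  have "finite T" using fin by (auto simp: T_def tight_excess_def intro: finite_subset[of _ "Pow V"])
  moreover have "T \<noteq> {}" using X by (auto simp: T_def)
  ultimately obtain Y where Y: "Y \<in> T" and Ymin: "\<And>Z. Z \<subset> Y \<Longrightarrow> Z \<notin> T"
    using finite_has_minimal[of T] by (metis psubset_eq)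
  show False
  proof (cases "tight_excess k V c Y")
    case True
    show False
      by (rule no_minimal_tight_excess[OF fin conn min big True]) (use Ymin in \<open>auto simp: T_def\<close>)
  next
    case False
    then have rY: "tight_excess k V ?r Y" using Y by (auto simp: T_def)
    have rr: "rev_weight ?r = c" by (auto simp: rev_weight_def fun_eq_iff)
    show False
      by (rule no_minimal_tight_excess[OF fin conn' min' _ rY])
        (use Ymin big in \<open>auto simp: T_def cap_converse rr\<close>)
  qed
qed

section \<open>Colouring\<close>

lemma cut_connected_cong:
  assumes "cut_connected k V c" "\<And>x y. x \<in> V \<Longrightarrow> y \<in> V \<Longrightarrow> x \<noteq> y \<Longrightarrow> c x y \<le> d x y"
  shows "cut_connected k V d"
  unfolding cut_connected_def
proof (intro allI impI)
  fix X assume "X \<noteq> {} \<and> X \<subset> V"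
  then have X: "X \<subset> V" "X \<noteq> {}" by simp_all
  have "k \<le> cap c X (V - X)" by (rule cut_connectedD) (use assms X in auto)
  also have "\<dots> \<le> cap d X (V - X)" by (rule cap_mono) (use assms X in auto)
  finally show "k \<le> cap d X (V - X)" .
qed

text \<open>Choose \<open>d\<close> with least total weight. Lowering a positive entry by one must
  violate some cut; that cut contains the entry and was tight before.\<close>

lemma exists_minimal_weight:
  assumes fin: "finite V" and conn: "cut_connected k V c"
  obtains d where "\<And>x y. d x y \<le> c x y" "cut_connected k V d" "\<And>x. x \<in> V \<Longrightarrow> d x x = 0"
    "\<And>x y. x \<in> V \<Longrightarrow> y \<in> V \<Longrightarrow> 0 < d x y \<Longrightarrow>
       \<exists>X\<subset>V. x \<in> X \<and> y \<notin> X \<and> cap d X (V - X) = k"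
proof -
  define \<Phi> where "\<Phi> d \<longleftrightarrow> (\<forall>x y. d x y \<le> c x y) \<and> cut_connected k V d" for d
  have "\<Phi> c" using conn by (simp add: \<Phi>_def)
  then obtain d where d: "\<Phi> d" and least: "\<And>d'. \<Phi> d' \<Longrightarrow> cap d V V \<le> cap d' V V"
    using ex_has_least_nat[of \<Phi> c "\<lambda>d. cap d V V"] by blast
  have dec: "\<exists>X\<subset>V. x \<in> X \<and> y \<notin> X \<and> cap d X (V - X) = k"
    if xy: "x \<in> V" "y \<in> V" "0 < d x y" for x y
  proof -
    define d' where "d' p q = (if p = x \<and> q = y then d p q - 1 else d p q)" for p q
    have "d = (\<lambda>p q. d' p q + (if p = x \<and> q = y then 1 else 0))"
      using xy by (auto simp: d'_def fun_eq_iff)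
    then have eq: "cap d X Y = cap d' X Y + (if x \<in> X \<and> y \<in> Y then 1 else 0)"
      if "finite X" "finite Y" for X Y
      using cap_add[of d' "\<lambda>p q. if p = x \<and> q = y then 1 else 0" X Y] cap_indicator[OF that, of x y]
      by simp
    have "\<not> \<Phi> d'" using least[of d'] eq[OF fin fin] xy by auto
    moreover have "\<forall>p q. d' p q \<le> c p q"
      using d by (auto simp: \<Phi>_def d'_def intro: le_trans[OF diff_le_self])
    ultimately obtain X where X: "X \<subset> V" "X \<noteq> {}" "cap d' X (V - X) < k"
      by (auto simp: \<Phi>_def cut_connected_def not_le)
    have "finite X" "finite (V - X)" using X fin by (auto intro: finite_subset)
    note eq = eq[OF this]
    have "k \<le> cap d X (V - X)" using d X by (auto simp: \<Phi>_def intro: cut_connectedD)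
    then show ?thesis using eq X by (intro exI[of _ X]) (auto split: if_splits)
  qed
  \<comment> \<open>No set separates \<open>x\<close> from itself, so a positive loop would
    contradict \<open>dec\<close>.\<close>
  moreover have "d x x = 0" if "x \<in> V" for x
    using dec[OF that that] by auto
  ultimately show ?thesis using d by (intro that[of d]) (auto simp: \<Phi>_def)
qed

lemma weight_colouring:
  assumes "finite V" "cut_connected k V c"
  shows "\<exists>d f. (\<forall>x y. d x y \<le> c x y) \<and> cut_connected k V d \<and>
    (\<forall>x\<in>V. f x < 2 * k + 1) \<and> (\<forall>x\<in>V. \<forall>y\<in>V. x \<noteq> y \<and> 0 < d x y \<longrightarrow> f x \<noteq> (f y :: nat))"
  using assms
proof (induction "card V" arbitrary: V c rule: less_induct)
  case less
  note fin = less(2) and conn = less(3)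
  show ?case
  proof (cases "\<exists>x\<in>V. \<exists>y\<in>V. x \<noteq> y")
    case False
    then show ?thesis
      using conn by (intro exI[of _ c] exI[of _ "\<lambda>_. 0"]) (simp; metis)
  next
    case True
    then have V: "V \<noteq> {}" "\<And>x. {x} \<noteq> V" by auto
    obtain d where d: "\<And>x y. d x y \<le> c x y" "cut_connected k V d" "\<And>x. x \<in> V \<Longrightarrow> d x x = 0"
      "\<And>x y. x \<in> V \<Longrightarrow> y \<in> V \<Longrightarrow> 0 < d x y \<Longrightarrow>
         \<exists>X\<subset>V. x \<in> X \<and> y \<notin> X \<and> cap d X (V - X) = k"
      using exists_minimal_weight[OF fin conn] by blast
    \<comment> \<open>As \<open>d\<close> has no loops, the degrees of a vertex are the values of
      cuts, so they are at least \<open>k\<close>.\<close>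
    have star: "cap d {x} V = cap d {x} (V - {x})" "cap d V {x} = cap d (V - {x}) {x}"
      if "x \<in> V" for x
      using cap_diff_right[OF fin, of "{x}" d "{x}"] cap_diff_left[OF fin, of "{x}" d "{x}"]
        that d(3)[OF that] by (auto simp: cap_def)
    have "k \<le> cap d {x} V" "k \<le> cap d V {x}" if "x \<in> V" for x
      using cut_connectedD[OF d(2), of "{x}"] V that star[OF that]
        cut_connectedD[OF cut_connected_converse[OF d(2)], of "{x}"] by (auto simp: cap_converse)
    then obtain s where s: "s \<in> V" "cap d {s} V = k" "cap d V {s} = k"
      using exists_vertex_of_degree_k[OF fin V(1) d(2) _ _ d(4)] by blast
    define U where "U = V - {s}"
    have U: "finite U" "s \<notin> U" "V = insert s U" "card U < card V"
      using fin s(1) card_Diff1_less[OF fin s(1)] by (auto simp: U_def)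
    define a b where "a x = d x s" and "b y = d s y" for x y
    have sa: "sum a X = cap d X {s}" and sb: "sum b X = cap d {s} X" for X
      by (simp_all add: a_def b_def cap_def)
    have ka: "sum a U = k" and kb: "sum b U = k"
      using s star[OF s(1)] by (simp_all add: sa sb U_def)
    have right: "cap e X (V - X) = cap e X (U - X) + cap e X {s}" if "X \<subset> U" for X e
    proof -
      have "V - X = (U - X) \<union> {s}" using that U by auto
      then show ?thesis using cap_Un_right[of "U - X" "{s}" e X] U by auto
    qed
    have left: "cap e (V - X) X = cap e (U - X) X + cap e {s} X" if "X \<subset> U" for X e
      using right[OF that, of "rev_weight e"] by (simp add: cap_converse)
    have XV: "X \<subset> V" if "X \<subset> U" for X using that U by auto
    have conn_out: "k \<le> cap d X (U - X) + sum a X" and conn_in: "k \<le> cap d (U - X) X + sum b X"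
      if X: "X \<noteq> {}" "X \<subset> U" for X
      using cut_connectedD[OF d(2) X(1) XV[OF X(2)]]
        cut_connectedD[OF cut_connected_converse[OF d(2)] X(1) XV[OF X(2)]]
      by (simp_all add: cap_converse right[OF X(2)] left[OF X(2)] sa sb)
    obtain t where t: "\<forall>x\<in>U. (\<Sum>y\<in>U. t x y) = a x" "\<forall>y\<in>U. (\<Sum>x\<in>U. t x y) = b y"
      "cut_connected k U (\<lambda>x y. d x y + t x y)"
      using split_off[of U a b k d, OF U(1) _ conn_out conn_in] ka kb by auto
    obtain e f where e: "\<And>x y. e x y \<le> d x y + t x y" "cut_connected k U e"
      "\<And>x. x \<in> U \<Longrightarrow> f x < 2 * k + 1"
      "\<And>x y. x \<in> U \<Longrightarrow> y \<in> U \<Longrightarrow> x \<noteq> y \<Longrightarrow> 0 < e x y \<Longrightarrow> f x \<noteq> (f y :: nat)"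
      using less(1)[OF U(4,1) t(3)] by blast
    \<comment> \<open>All arcs at \<open>s\<close> return in full. Elsewhere the minimum with
      \<open>d\<close> keeps only original arcs and lowers \<open>e x y\<close> by at most
      \<open>t x y\<close>.\<close>
    define h where "h x y = (if x = s \<or> y = s then d x y else min (e x y) (d x y))" for x y
    have hs: "cap h X {s} = sum a X" "cap h {s} X = sum b X" for X
      by (simp_all add: h_def cap_def a_def b_def)
    have e_le: "cap e X (U - X) \<le> cap h X (U - X) + cap t X (U - X)" if "X \<subset> U" for X
      unfolding cap_add[symmetric]
      by (rule cap_mono) (use e(1) U that in \<open>auto simp: h_def min_def\<close>)
    \<comment> \<open>A split arc leaving \<open>X\<close> stems from an arc from \<open>X\<close>
      to \<open>s\<close> and one from \<open>s\<close> to \<open>U - X\<close>. Hence the restored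
      arcs at \<open>s\<close> make up for the split arcs lost, whichever side \<open>s\<close> is
      on.\<close>
    have t_le: "cap t X (U - X) \<le> sum a X" "cap t X (U - X) \<le> sum b (U - X)" if "X \<subset> U" for X
    proof -
      have fX: "finite X" using that U by (auto intro: finite_subset)
      have "cap t X (U - X) \<le> cap t X U" by (rule cap_subset) (use U fX in auto)
      also have "\<dots> = sum a X" unfolding cap_def by (rule sum.cong) (use t that in auto)
      finally show "cap t X (U - X) \<le> sum a X" .
      have "cap t X (U - X) \<le> cap t U (U - X)" by (rule cap_subset) (use U that in auto)
      also have "\<dots> = (\<Sum>y\<in>U - X. \<Sum>x\<in>U. t x y)" unfolding cap_def by (rule sum.swap)
      also have "\<dots> = sum b (U - X)" by (rule sum.cong) (use t in auto)
      finally show "cap t X (U - X) \<le> sum b (U - X)" .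
    qed
    have "cut_connected k V h"
      unfolding cut_connected_def
    proof (intro allI impI)
      fix X assume "X \<noteq> {} \<and> X \<subset> V"
      then have X: "X \<subset> V" "X \<noteq> {}" by simp_all
      \<comment> \<open>The first two cuts isolate \<open>s\<close> and have value \<open>k\<close>;
        the other two induce proper cuts of \<open>U\<close>, where \<open>e\<close> is
        connected.\<close>
      consider "X = U" | "X = {s}" | "X \<subset> U" | X' where "X = insert s X'" "X' \<subset> U" "X' \<noteq> {}"
      proof (cases "s \<in> X")
        case True
        then have "X = insert s (X - {s})" "X - {s} \<subset> U" using X U by auto
        then show thesis using that(2) that(4)[of "X - {s}"] by (cases "X - {s} = {}") auto
      next
        case False
        then show thesis using X U that(1,3) by auto
      qed
      then show "k \<le> cap h X (V - X)"
      proof cases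
        case 1
        then have "V - X = {s}" using U by auto
        then show ?thesis using 1 ka by (simp add: hs)
      next
        case 2
        then have "V - X = U" using U by auto
        then show ?thesis using 2 kb by (simp add: hs)
      next
        case 3
        show ?thesis
          using cut_connectedD[OF e(2) X(2) 3] e_le[OF 3] t_le(1)[OF 3] by (simp add: right[OF 3] hs)
      next
        case 4
        have VX: "V - X = U - X'" using U 4 by auto
        have "finite X'" "s \<notin> X'" using 4 U by (auto intro: finite_subset)
        then have "cap h X (U - X') = cap h X' (U - X') + cap h {s} (U - X')"
          using cap_Un_left[of X' "{s}" h] 4 by auto
        then show ?thesis
          using cut_connectedD[OF e(2) 4(3,2)] e_le[OF 4(2)] t_le(2)[OF 4(2)] by (simp add: VX hs)
      qed
    qed
    moreover have "h x y \<le> c x y" for x y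
      using d(1)[of x y] by (auto simp: h_def)
    \<comment> \<open>The supports of \<open>a\<close> and \<open>b\<close> have at most
      \<open>k\<close> elements each, so some colour is absent from the neighbours of
      \<open>s\<close>.\<close>
    moreover obtain j where j: "j < 2 * k + 1" "\<And>y. y \<in> U \<Longrightarrow> 0 < a y \<or> 0 < b y \<Longrightarrow> f y \<noteq> j"
    proof -
      have supp: "card {y\<in>U. 0 < g y} \<le> sum g U" for g :: "'a \<Rightarrow> nat"
      proof -
        have "card {y\<in>U. 0 < g y} = (\<Sum>y | y \<in> U \<and> 0 < g y. 1)" by simp
        also have "\<dots> \<le> (\<Sum>y | y \<in> U \<and> 0 < g y. g y)" by (rule sum_mono) auto
        also have "\<dots> \<le> sum g U" by (rule sum_mono2) (use U in auto)
        finally show ?thesis .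
      qed
      let ?N = "{y\<in>U. 0 < a y} \<union> {y\<in>U. 0 < b y}"
      have "card (f ` ?N) \<le> card ?N" by (rule card_image_le) (use U in auto)
      also have "\<dots> \<le> card {y\<in>U. 0 < a y} + card {y\<in>U. 0 < b y}" by (rule card_Un_le)
      also have "\<dots> < card {..<2 * k + 1}" using supp[of a] supp[of b] ka kb by simp
      finally have "\<not> {..<2 * k + 1} \<subseteq> f ` ?N"
        using card_mono[of "f ` ?N" "{..<2 * k + 1}"] U by auto
      then show thesis using that by auto
    qed
    moreover have "(if x = s then j else f x) \<noteq> (if y = s then j else f y)"
      if "x \<in> V" "y \<in> V" "x \<noteq> y" "0 < h x y" for x y
      using that e(4)[of x y] j(2)[of x] j(2)[of y] U by (auto simp: h_def a_def b_def split: if_splits)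
    ultimately show ?thesis
      using e(3) U by (intro exI[of _ h] exI[of _ "\<lambda>x. if x = s then j else f x"]) auto
  qed
qed

section \<open>Digraphs and their multiplicities\<close>

definition arc_mult :: "('a, 'b) pre_digraph \<Rightarrow> 'a \<Rightarrow> 'a \<Rightarrow> nat" where
  "arc_mult G x y = card {e \<in> arcs G. tail G e = x \<and> head G e = y}"

lemma card_cut_arcs:
  assumes "finite (verts G)" "finite (arcs G)" "X \<subseteq> verts G"
  shows "card (cut_arcs G X) = cap (arc_mult G) X (verts G - X)"
proof -
  have "cut_arcs G X = (\<Union>(x, y)\<in>X \<times> (verts G - X). {e \<in> arcs G. tail G e = x \<and> head G e = y})"
    by (auto simp: cut_arcs_def)
  also have "card \<dots> = (\<Sum>p\<in>X \<times> (verts G - X). arc_mult G (fst p) (snd p))"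
    unfolding arc_mult_def case_prod_beta
    by (rule card_UN_disjoint) (use assms in \<open>auto intro: finite_subset\<close>)
  also have "\<dots> = cap (arc_mult G) X (verts G - X)"
    unfolding cap_def by (simp add: sum.cartesian_product case_prod_beta)
  finally show ?thesis .
qed

lemma arc_connected_iff:
  assumes "finite (verts G)" "finite (arcs G)"
  shows "arc_connected k G \<longleftrightarrow> cut_connected k (verts G) (arc_mult G)"
  unfolding arc_connected_def cut_connected_def
proof (intro iff_allI imp_cong refl)
  fix X assume "X \<noteq> {} \<and> X \<subset> verts G"
  then have "X \<subseteq> verts G" by blast
  then show "k \<le> card (cut_arcs G X) \<longleftrightarrow> k \<le> cap (arc_mult G) X (verts G - X)"
    by (simp only: card_cut_arcs[OF assms])
qed

lemma spanning_partite_subdigraph: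
  assumes G: "multi_digraph G" and conn: "arc_connected k G"
  shows "\<exists>H. spanning H G \<and> arc_connected k H \<and> partite (2 * k + 1) H"
proof -
  interpret multi_digraph G by fact
  obtain d f where d: "\<And>x y. d x y \<le> arc_mult G x y" "cut_connected k (verts G) d"
    "\<And>x. x \<in> verts G \<Longrightarrow> f x < 2 * k + 1"
    "\<And>x y. x \<in> verts G \<Longrightarrow> y \<in> verts G \<Longrightarrow> x \<noteq> y \<Longrightarrow> 0 < d x y \<Longrightarrow> f x \<noteq> (f y :: nat)"
    using weight_colouring[OF finite_verts, of k "arc_mult G"] conn
    unfolding arc_connected_iff[OF finite_verts finite_arcs] by metis
  \<comment> \<open>\<open>S x y\<close> picks \<open>d x y\<close> of the parallel arcs from
    \<open>x\<close> to \<open>y\<close>, turning the weight back into a set of arcs.\<close>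
  define S where "S x y = (SOME S. S \<subseteq> {e \<in> arcs G. tail G e = x \<and> head G e = y} \<and>
    card S = d x y)" for x y
  have S: "S x y \<subseteq> {e \<in> arcs G. tail G e = x \<and> head G e = y}" "card (S x y) = d x y" for x y
  proof -
    have "\<exists>S. S \<subseteq> {e \<in> arcs G. tail G e = x \<and> head G e = y} \<and> card S = d x y"
      by (rule obtain_subset_with_card_n[OF d(1)[of x y, unfolded arc_mult_def]]) blast
    note * = someI_ex[OF this, folded S_def]
    show "S x y \<subseteq> {e \<in> arcs G. tail G e = x \<and> head G e = y}" "card (S x y) = d x y"
      by (rule conjunct1[OF *], rule conjunct2[OF *])
  qed
  define H where "H = G\<lparr>arcs := (\<Union>x y. S x y)\<rparr>"
  have H: "verts H = verts G" "arcs H = (\<Union>x y. S x y)" "tail H = tail G" "head H = head G"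
    by (simp_all add: H_def)
  have sub: "arcs H \<subseteq> arcs G" unfolding H using S(1) by blast
  have mult: "arc_mult H x y = d x y" for x y
  proof -
    have "{e \<in> arcs H. tail H e = x \<and> head H e = y} = S x y"
      unfolding H using S(1) by blast
    then show ?thesis by (simp add: arc_mult_def S)
  qed
  have "wf_digraph H"
  proof
    fix e assume "e \<in> arcs H"
    then have "e \<in> arcs G" using sub by blast
    then show "tail H e \<in> verts H" "head H e \<in> verts H" by (simp_all add: H(1,3,4))
  qed
  then have "spanning H G"
    unfolding spanning_def subgraph_def compatible_def using sub H wf_digraph_axioms by auto
  moreover have finH: "finite (verts H)" "finite (arcs H)"
    using finite_subset[OF sub finite_arcs] by (simp_all add: H(1))
  then have "arc_connected k H"
    using d(2) arc_connected_iff[OF finH] mult by (simp add: H cut_connected_def cap_def)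
  moreover have "partite (2 * k + 1) H"
    unfolding partite_def
  proof (intro exI[of _ "\<lambda>i. {v \<in> verts G. f v = i}"] conjI allI impI)
    show "(\<Union>i<2 * k + 1. {v \<in> verts G. f v = i}) = verts H" using d(3) H by auto
    show "disjoint_family_on (\<lambda>i. {v \<in> verts G. f v = i}) {..<2 * k + 1}"
      by (auto simp: disjoint_family_on_def)
    fix i
    show "arcs (induce_subgraph H {v \<in> verts G. f v = i}) = {}"
    proof (rule ccontr)
      assume "\<not> ?thesis"
      then obtain e where e: "e \<in> arcs H" "f (tail G e) = i" "f (head G e) = i"
        by (auto simp: induce_subgraph_def H)
      then have "e \<in> arcs G" using sub by auto
      \<comment> \<open>Since \<open>G\<close> is loopless, the ends of \<open>e\<close> are
        distinct and the colour condition applies to them.\<close>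
      then have te: "tail G e \<in> verts G" "head G e \<in> verts G" "tail G e \<noteq> head G e"
        using wellformed no_loops by auto
      have "0 < arc_mult H (tail G e) (head G e)"
        unfolding arc_mult_def card_gt_0_iff using e(1) H(3,4) finH(2) by auto
      then show False using d(4)[OF te] mult e by simp
    qed
  qed
  ultimately show ?thesis by blast
qed

section \<open>Extremal digraphs\<close>

text \<open>An arc codes its tail, its head and a copy index below \<open>c x y\<close>; the index
  separates parallel arcs, and the decoding provides \<open>tail\<close> and
  \<open>head\<close>.\<close>

definition weight_digraph :: "nat set \<Rightarrow> (nat \<Rightarrow> nat \<Rightarrow> nat) \<Rightarrow> (nat, nat) pre_digraph" where
  "weight_digraph V c = \<lparr>verts = V,
     arcs = {prod_encode (x, prod_encode (y, i)) | x y i. x \<in> V \<and> y \<in> V \<and> i < c x y},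
     tail = (\<lambda>e. fst (prod_decode e)),
     head = (\<lambda>e. fst (prod_decode (snd (prod_decode e))))\<rparr>"

lemma weight_digraph_multi_digraph:
  assumes fin: "finite V" and loop: "\<And>x. c x x = 0"
  shows "multi_digraph (weight_digraph V c)"
proof -
  have "arcs (weight_digraph V c) = (\<Union>x\<in>V. \<Union>y\<in>V. (\<lambda>i. prod_encode (x, prod_encode (y, i))) ` {..<c x y})"
    by (auto simp: weight_digraph_def)
  then have "finite (arcs (weight_digraph V c))" using fin by simp
  then show ?thesis
    by unfold_locales (use assms in \<open>auto simp: weight_digraph_def\<close>)
qed

lemma arc_mult_weight_digraph:
  assumes "x \<in> V" "y \<in> V"
  shows "arc_mult (weight_digraph V c) x y = c x y"
proof -
  have "{e \<in> arcs (weight_digraph V c). tail (weight_digraph V c) e = x \<and> head (weight_digraph V c) e = y}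
      = (\<lambda>i. prod_encode (x, prod_encode (y, i))) ` {..<c x y}"
    using assms by (auto simp: weight_digraph_def)
  moreover have "inj_on (\<lambda>i. prod_encode (x, prod_encode (y, i))) {..<c x y}"
    by (auto simp: inj_on_def prod_encode_eq)
  ultimately show ?thesis by (simp add: arc_mult_def card_image)
qed

text \<open>A rotational tournament on \<open>{..2 * k}\<close>, where every vertex \<open>i > 2 * k\<close> is attached to the
  tournament vertex \<open>0\<close> by \<open>k\<close> arcs in each direction.\<close>

definition pendant_tournament :: "nat \<Rightarrow> nat \<Rightarrow> nat \<Rightarrow> nat" where
  "pendant_tournament k i j =
    (if i \<le> 2 * k \<and> j \<le> 2 * k then (if i < j \<and> j \<le> i + k \<or> j + k < i then 1 else 0)
     else if i = 0 \<or> j = 0 then k else 0)"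

lemma pendant_tournament_loopfree: "pendant_tournament k i i = 0"
  by (auto simp: pendant_tournament_def)

lemma pendant_tournament_sym:
  "i \<le> 2 * k \<Longrightarrow> j \<le> 2 * k \<Longrightarrow> i \<noteq> j \<Longrightarrow>
    pendant_tournament k i j + pendant_tournament k j i = 1"
  by (auto simp: pendant_tournament_def)

section \<open>Degrees and cuts of the rotational tournament\<close>

lemma sum_indicator_card: "finite A \<Longrightarrow> (\<Sum>x\<in>A. if P x then 1 else 0) = card {x\<in>A. P x}"
  by (simp add: sum.If_cases Int_def)

text \<open>The out-neighbours of \<open>i\<close> are the next \<open>k\<close> residues modulo
  \<open>2 * k + 1\<close>; the condition \<open>j + k < i\<close> describes those that wrap
  around.\<close>

lemma tournament_out:
  assumes "i \<le> 2 * k"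
  shows "cap (pendant_tournament k) {i} {..2 * k} = k"
proof -
  have "cap (pendant_tournament k) {i} {..2 * k} =
      (\<Sum>j\<le>2 * k. if i < j \<and> j \<le> i + k \<or> j + k < i then 1 else 0)"
    using assms by (simp add: cap_def pendant_tournament_def)
  also have "\<dots> = card {j\<in>{..2 * k}. i < j \<and> j \<le> i + k \<or> j + k < i}"
    by (rule sum_indicator_card) simp
  also have "{j\<in>{..2 * k}. i < j \<and> j \<le> i + k \<or> j + k < i} =
      {i<..min (i + k) (2 * k)} \<union> {..<i - k}"
    using assms by auto
  also have "card \<dots> = card {i<..min (i + k) (2 * k)} + card {..<i - k}"
    by (rule card_Un_disjoint) auto
  also have "\<dots> = k" using assms by (auto simp: min_def)
  finally show ?thesis .
qed

text \<open>Each of the other \<open>2 * k\<close> vertices is joined to \<open>i\<close> by exactly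
  one arc, and \<open>k\<close> of these arcs leave \<open>i\<close>.\<close>

lemma tournament_in:
  assumes "i \<le> 2 * k"
  shows "cap (pendant_tournament k) {..2 * k} {i} = k"
proof -
  have "cap (pendant_tournament k) {..2 * k} {i} + cap (pendant_tournament k) {i} {..2 * k} =
      (\<Sum>j\<le>2 * k. pendant_tournament k j i + pendant_tournament k i j)"
    by (simp add: cap_def sum.distrib)
  also have "\<dots> = (\<Sum>j\<le>2 * k. if j \<noteq> i then 1 else 0)"
    using assms by (intro sum.cong refl) (auto simp: pendant_tournament_sym pendant_tournament_loopfree)
  also have "\<dots> = card ({..2 * k} - {i})"
    by (subst sum_indicator_card) (auto intro: arg_cong[where f = card])
  also have "\<dots> = 2 * k" using assms by simp
  finally show ?thesis using tournament_out[OF assms] by simp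
qed

lemma tournament_inner:
  assumes "X \<subseteq> {..2 * k}"
  shows "2 * cap (pendant_tournament k) X X = card X * (card X - 1)"
proof -
  let ?c = "pendant_tournament k"
  have fin: "finite X" using assms by (rule finite_subset) simp
  have "2 * cap ?c X X = cap (\<lambda>x y. ?c x y + rev_weight ?c x y) X X"
    by (simp add: cap_add cap_converse)
  also have "\<dots> = (\<Sum>x\<in>X. \<Sum>y\<in>X. if y \<noteq> x then 1 else 0)"
    unfolding cap_def rev_weight_def
    using assms by (intro sum.cong refl) (auto simp: pendant_tournament_sym pendant_tournament_loopfree subset_iff)
  also have "\<dots> = (\<Sum>x\<in>X. card (X - {x}))"
    by (intro sum.cong refl, subst sum_indicator_card)
      (auto simp: fin set_diff_eq intro!: arg_cong[where f = card])
  also have "\<dots> = card X * (card X - 1)" using fin by simp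
  finally show ?thesis .
qed

text \<open>Subtracting the arcs inside \<open>X\<close> from the sum of its out-degrees shows that
  twice the cut is \<open>card X * (2 * k + 1 - card X)\<close>. For
  \<open>1 \<le> card X \<le> 2 * k\<close> this product is at least \<open>2 * k\<close>.\<close>

lemma tournament_cut:
  assumes X: "X \<subset> {..2 * k}" "X \<noteq> {}"
  shows "k \<le> cap (pendant_tournament k) X ({..2 * k} - X)"
proof -
  let ?c = "pendant_tournament k"
  have fin: "finite X" using X by (auto intro: finite_subset)
  have "cap ?c X {..2 * k} = (\<Sum>x\<in>X. k)"
    unfolding cap_eq_sum_left[OF fin, of ?c "{..2 * k}"]
    by (rule sum.cong) (use X in \<open>auto simp: tournament_out\<close>)
  then have 1: "cap ?c X {..2 * k} = k * card X" by (simp add: mult.commute)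
  have 2: "cap ?c X {..2 * k} = cap ?c X X + cap ?c X ({..2 * k} - X)"
    by (rule cap_diff_right) (use X in auto)
  have 3: "2 * cap ?c X X = card X * (card X - 1)" by (rule tournament_inner) (use X in auto)
  have "0 < card X" using X fin by (simp add: card_gt_0_iff)
  then obtain i where i: "card X = Suc i" by (metis gr0_implies_Suc)
  have "card X < card {..2 * k}" using psubset_card_mono[OF _ X(1)] by simp
  then have "i < 2 * k" using i by simp
  \<comment> \<open>With \<open>card X = i + 1\<close> and \<open>2 * k = i + 1 + l\<close>, twice
    the cut is \<open>(i + 1) * (l + 1)\<close>, which exceeds \<open>2 * k\<close> by
    \<open>l * i\<close>.\<close>
  then obtain l where l: "2 * k = Suc i + l" by (metis less_imp_Suc_add add_Suc)
  have "2 * (k * Suc i) = Suc i * i + 2 * cap ?c X ({..2 * k} - X)" using 1 2 3 i by simp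
  then have "(Suc i + l) * Suc i = Suc i * i + 2 * cap ?c X ({..2 * k} - X)"
    using l by (metis mult.assoc)
  then have "2 * cap ?c X ({..2 * k} - X) = Suc i + l + l * i" by (simp add: algebra_simps)
  then show ?thesis using l by linarith
qed

text \<open>A cut separating an attached vertex from \<open>0\<close> already contains
  \<open>k\<close> parallel arcs. Otherwise all attached vertices lie on the side of
  \<open>0\<close>, and the cut restricts to a proper cut of the tournament.\<close>

lemma pendant_tournament_connected:
  assumes V: "V = {..<2 * k + 1 + m}"
  shows "cut_connected k V (pendant_tournament k)"
  unfolding cut_connected_def
proof (intro allI impI)
  let ?c = "pendant_tournament k"
  fix X assume "X \<noteq> {} \<and> X \<subset> V"
  then have X: "X \<subset> V" "X \<noteq> {}" by simp_all
  have fin: "finite X" "finite (V - X)" using X V by (auto intro: finite_subset)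
  have one: "?c x y \<le> cap ?c X (V - X)" if "x \<in> X" "y \<in> V - X" for x y
    using cap_subset[OF fin, of "{x}" "{y}" ?c] that by (simp add: cap_def)
  have 0: "0 \<in> V" using V by simp
  show "k \<le> cap ?c X (V - X)"
  proof (cases "\<exists>e\<in>V. 2 * k < e \<and> (e \<in> X) \<noteq> (0 \<in> X)")
    case True
    then obtain e where e: "e \<in> V" "2 * k < e" "(e \<in> X) \<noteq> (0 \<in> X)" by blast
    then have "?c 0 e = k" "?c e 0 = k" by (auto simp: pendant_tournament_def)
    then show ?thesis using one[of 0 e] one[of e 0] e 0 by auto
  next
    case False
    then have same: "\<And>e. e \<in> V \<Longrightarrow> 2 * k < e \<Longrightarrow> e \<in> X \<longleftrightarrow> 0 \<in> X" by blast
    let ?Y = "X \<inter> {..2 * k}"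
    obtain x where "x \<in> X" using X by auto
    then have "?Y \<noteq> {}" using same[of x] X by (cases "x \<le> 2 * k") auto
    moreover obtain y where "y \<in> V - X" using X by auto
    then have "\<exists>y\<le>2 * k. y \<notin> X" using same[of y] by (cases "y \<le> 2 * k") auto
    then have "?Y \<subset> {..2 * k}" by auto
    ultimately have "k \<le> cap ?c ?Y ({..2 * k} - ?Y)" by (intro tournament_cut)
    also have "\<dots> \<le> cap ?c X (V - X)" by (rule cap_subset) (use fin V in auto)
    finally show ?thesis .
  qed
qed

text \<open>A loss in a single entry would make the whole sum strictly smaller. This is how a vertex
  of degree \<open>k\<close> is shown to keep all its arcs.\<close>

lemma cap_eqD:
  assumes "finite X" "finite Y" "\<And>x y. x \<in> X \<Longrightarrow> y \<in> Y \<Longrightarrow> d x y \<le> c x y" "cap c X Y \<le> cap d X Y"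
    "x \<in> X" "y \<in> Y"
  shows "d x y = c x y"
proof (rule ccontr)
  assume "d x y \<noteq> c x y"
  then have lt: "d x y < c x y" using assms(3)[OF assms(5,6)] by simp
  have "cap d X Y < cap c X Y"
    unfolding cap_def
  proof (rule sum_strict_mono_ex1)
    show "\<forall>x\<in>X. (\<Sum>y\<in>Y. d x y) \<le> (\<Sum>y\<in>Y. c x y)" using assms by (auto intro: sum_mono)
    have "(\<Sum>y\<in>Y. d x y) < (\<Sum>y\<in>Y. c x y)"
      by (rule sum_strict_mono_ex1) (use assms lt in auto)
    then show "\<exists>x\<in>X. (\<Sum>y\<in>Y. d x y) < (\<Sum>y\<in>Y. c x y)" using assms by blast
  qed (use assms in auto)
  then show False using assms(4) by simp
qed

lemma pendant_tournament_not_partite: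
  fixes k m :: nat
  defines "V \<equiv> {..<2 * k + 1 + m}"
  defines "G \<equiv> weight_digraph V (pendant_tournament k)"
  assumes "spanning H G" and conn: "arc_connected k H"
  shows "\<not> partite (2 * k) H"
proof
  let ?c = "pendant_tournament k"
  have H: "verts H = V" "arcs H \<subseteq> arcs G" "tail H = tail G" "head H = head G"
    using assms(3) by (auto simp: spanning_def subgraph_def compatible_def G_def weight_digraph_def)
  interpret G: multi_digraph G
    unfolding G_def by (rule weight_digraph_multi_digraph) (auto simp: V_def pendant_tournament_loopfree)
  have fin: "finite V" by (simp add: V_def)
  have finH: "finite (verts H)" "finite (arcs H)" using H fin finite_subset[OF H(2)] by auto
  have connH: "cut_connected k V (arc_mult H)" using conn arc_connected_iff[OF finH] H by simp
  have le: "arc_mult H x y \<le> ?c x y" if "x \<in> V" "y \<in> V" for x y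
  proof -
    have "arc_mult H x y \<le> arc_mult G x y"
      unfolding arc_mult_def by (rule card_mono) (use H in auto)
    then show ?thesis using arc_mult_weight_digraph[OF that] by (simp add: G_def)
  qed
  have TV: "{..2 * k} \<subseteq> V" by (auto simp: V_def)
  have keep: "arc_mult H i j = ?c i j" "arc_mult H j i = ?c j i" if j: "0 < j" "j \<le> 2 * k" "i \<in> V - {j}" for i j
  proof -
    have jV: "j \<in> V" "{j} \<subset> V" using j TV by (auto simp: psubset_eq)
    have z: "cap ?c {j} (V - {..2 * k}) = 0" "cap ?c (V - {..2 * k}) {j} = 0"
      using j by (auto simp: cap_def pendant_tournament_def)
    have "cap ?c {j} V = k"
      using cap_diff_right[OF fin TV, of ?c "{j}"] z tournament_out[OF j(2)] by simp
    then have out: "cap ?c {j} (V - {j}) \<le> k"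
      using cap_subset[of "{j}" V "{j}" "V - {j}" ?c] fin by auto
    have "cap ?c V {j} = k"
      using cap_diff_left[OF fin TV, of ?c "{j}"] z tournament_in[OF j(2)] by simp
    then have inn: "cap ?c (V - {j}) {j} \<le> k"
      using cap_subset[of V "{j}" "V - {j}" "{j}" ?c] fin by auto
    have kout: "k \<le> cap (arc_mult H) {j} (V - {j})"
      by (rule cut_connectedD[OF connH]) (use jV in auto)
    have kinn: "k \<le> cap (arc_mult H) (V - {j}) {j}"
      using cut_connectedD[OF cut_connected_converse[OF connH], of "{j}"] jV by (simp add: cap_converse)
    show "arc_mult H j i = ?c j i"
    proof (rule cap_eqD[where X = "{j}" and Y = "V - {j}" and d = "arc_mult H" and c = "?c"])
      show "cap ?c {j} (V - {j}) \<le> cap (arc_mult H) {j} (V - {j})" using out kout by (rule le_trans)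
    qed (use fin le jV(1) j(3) in auto)
    show "arc_mult H i j = ?c i j"
    proof (rule cap_eqD[where X = "V - {j}" and Y = "{j}" and d = "arc_mult H" and c = "?c"])
      show "cap ?c (V - {j}) {j} \<le> cap (arc_mult H) (V - {j}) {j}" using inn kinn by (rule le_trans)
    qed (use fin le jV(1) j(3) in auto)
  qed
  assume "partite (2 * k) H"
  then obtain P where P: "(\<Union>i<2 * k. P i) = V"
      "\<forall>i<2 * k. arcs (induce_subgraph H (P i)) = {}"
    unfolding partite_def H(1) by (elim exE conjE)
  have "\<forall>v\<in>V. \<exists>i<2 * k. v \<in> P i" using P(1) by auto
  then obtain g where g: "\<And>v. v \<in> V \<Longrightarrow> g v < 2 * k \<and> v \<in> P (g v)" by metis
  have "card (g ` {..2 * k}) \<le> card {..<2 * k}"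
    by (rule card_mono) (use g TV in auto)
  then have "\<not> inj_on g {..2 * k}" by (intro pigeonhole) simp
  then obtain p q where pq: "p \<le> 2 * k" "q \<le> 2 * k" "p \<noteq> q" "g p = g q" by (auto simp: inj_on_def)
  \<comment> \<open>By pigeonhole two of the \<open>2 * k + 1\<close> tournament vertices share a
    class. The larger one is not \<open>0\<close>, so \<open>keep\<close> preserves the arc joining
    them.\<close>
  define i j where "i = min p q" and "j = max p q"
  have ij: "i < j" "j \<le> 2 * k" "g i = g j" "i \<in> V" "j \<in> V"
    using pq TV by (auto simp: i_def j_def min_def max_def)
  have "0 < arc_mult H i j + arc_mult H j i"
    using keep[of j i] pendant_tournament_sym[of i k j] ij by simp
  then obtain e where "e \<in> arcs H" "tail H e \<in> {i, j}" "head H e \<in> {i, j}"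
    by (auto simp: arc_mult_def card_gt_0_iff)
  then have "e \<in> arcs (induce_subgraph H (P (g j)))"
    using g[OF ij(4)] g[OF ij(5)] ij(3) by (auto simp: induce_subgraph_def)
  then show False using P(2) g[OF ij(5)] by auto
qed

lemma digraph_iso_card_verts: "digraph_iso G H \<Longrightarrow> card (verts G) = card (verts H)"
  by (auto simp: digraph_iso_def pre_digraph.digraph_isomorphism_def app_iso_def card_image)

theorem theorem6p4:
  fixes k :: nat
  assumes "k > 0"
  shows "(\<forall>G :: ('a, 'b) pre_digraph. multi_digraph G \<and> arc_connected k G \<longrightarrow>
            (\<exists>H. spanning H G \<and> arc_connected k H \<and> partite (2 * k + 1) H)) \<and>
         (\<exists>\<G> :: (nat, nat) pre_digraph set.
            infinite \<G> \<and> pairwise (\<lambda>G G'. \<not> digraph_iso G G') \<G> \<and>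
            (\<forall>G\<in>\<G>. multi_digraph G \<and> arc_connected k G \<and>
               \<not> (\<exists>H. spanning H G \<and> arc_connected k H \<and> partite (2 * k) H)))"
proof
  show "\<forall>G :: ('a, 'b) pre_digraph. multi_digraph G \<and> arc_connected k G \<longrightarrow>
    (\<exists>H. spanning H G \<and> arc_connected k H \<and> partite (2 * k + 1) H)"
    using spanning_partite_subdigraph by blast
next
  define V where "V m = {..<2 * k + 1 + m}" for m
  define D where "D m = weight_digraph (V m) (pendant_tournament k)" for m
  have vD: "verts (D m) = V m" for m by (simp add: D_def weight_digraph_def)
  have md: "multi_digraph (D m)" for m
    unfolding D_def by (rule weight_digraph_multi_digraph) (auto simp: V_def pendant_tournament_loopfree)
  have "arc_connected k (D m)" for m
  proof -
    interpret multi_digraph "D m" by (rule md)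
    have "cut_connected k (V m) (arc_mult (D m))"
      using pendant_tournament_connected[OF V_def]
      by (rule cut_connected_cong) (simp add: D_def arc_mult_weight_digraph)
    then show ?thesis using arc_connected_iff[of "D m" k] by (simp add: vD V_def)
  qed
  \<comment> \<open>The number of vertices determines \<open>m\<close>; this makes the family
    infinite and its members pairwise non-isomorphic.\<close>
  moreover have card: "card (verts (D m)) = 2 * k + 1 + m" for m by (simp add: vD V_def)
  then have "inj D" by (metis add_left_cancel injI)
  then have "infinite (range D)" by (rule range_inj_infinite)
  moreover have "pairwise (\<lambda>G G'. \<not> digraph_iso G G') (range D)"
  proof (rule pairwiseI, safe)
    fix m n assume "D m \<noteq> D n" "digraph_iso (D m) (D n)"
    then show False using digraph_iso_card_verts[of "D m" "D n"] card by auto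
  qed
  moreover have "\<not> partite (2 * k) H" if "spanning H (D m)" "arc_connected k H" for H m
    using pendant_tournament_not_partite[OF that[unfolded D_def V_def]] .
  ultimately show "\<exists>\<G> :: (nat, nat) pre_digraph set.
            infinite \<G> \<and> pairwise (\<lambda>G G'. \<not> digraph_iso G G') \<G> \<and>
            (\<forall>G\<in>\<G>. multi_digraph G \<and> arc_connected k G \<and>
               \<not> (\<exists>H. spanning H G \<and> arc_connected k H \<and> partite (2 * k) H))"
    using md by (intro exI[of _ "range D"]) blast
qed

end
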